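(* For each integer $n\ge 2$ let $f_1,f_2,f_3,\dots$ be independent random functions, each uniformly distributed over the $n^n$ functions from $[n]=\{1,\dots,n\}$ to $[n]$. Put $g_1=f_1$ and $g_t=f_t\circ g_{t-1}$ for $t>1$, and let $T$ be the smallest $t$ for which $g_t$ is a constant function (i.e. $g_t(i)=g_t(j)$ for all $i,j\in[n]$). Define, for $y>0$, $$f(y)=\sum_{k\ge 2}(-1)^k e^{-y\binom k2}(2k-1)\binom k2,$$ and $F(x)=\int_0^x f(y)\,dy$. Then for every real $x>0$, $$\lim_{n\to\infty}\Pr\left(\frac{T}{n}\le x\right)=F(x).$$ *)

theory Defs
  imports "HOL-Probability.Probability"
begin

definition maps_on :: "nat \<Rightarrow> (nat \<Rightarrow> nat) set" where
  "maps_on n = ({1..n} \<rightarrow>\<^sub>E {1..n})"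

text \<open>The value at index \<open>0\<close> is a dummy; the sequence starts at index \<open>1\<close>.\<close>

fun iter_comp :: "nat \<Rightarrow> (nat \<Rightarrow> nat \<Rightarrow> nat) \<Rightarrow> nat \<Rightarrow> nat \<Rightarrow> nat" where
  "iter_comp n \<phi> t =
     (if t \<le> 1 then \<phi> 1 else compose {1..n} (\<phi> t) (iter_comp n \<phi> (t - 1)))"

declare iter_comp.simps [simp del]

text \<open>The value is \<open>\<infinity>\<close> if no composition is constant on \<open>{1..n}\<close>.\<close>

definition hit_const_time :: "nat \<Rightarrow> (nat \<Rightarrow> nat \<Rightarrow> nat) \<Rightarrow> enat" where
  "hit_const_time n \<phi> =
     Inf {enat t |t. 1 \<le> t \<and> (\<forall>i\<in>{1..n}. \<forall>j\<in>{1..n}. iter_comp n \<phi> t i = iter_comp n \<phi> t j)}"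

definition limit_density :: "real \<Rightarrow> real" where
  "limit_density y =
     (\<Sum>\<^sub>\<infinity>k\<in>{2..}. (-1) ^ k * exp (- y * real (k choose 2)) * (2 * real k - 1) * real (k choose 2))"

definition limit_cdf :: "real \<Rightarrow> real" where
  "limit_cdf x = (LBINT y=0..ereal x. limit_density y)"

end

theory Submission
  imports Defs
begin

text \<open>
  The size of the image of \<open>g\<^sub>t\<close> is a Markov chain: from size \<open>i\<close>, throw \<open>i\<close> balls into \<open>n\<close> boxes and
  count the occupied boxes. Started from a fixed size \<open>m\<close> and run for \<open>x n\<close> steps it converges to
  Kingman's coalescent, which merges from \<open>i\<close> to \<open>i - 1\<close> at rate \<open>i choose 2\<close>; its absorption probabilities
  solve a triangular linear system of differential equations with an explicit solution.

  Since the probability of being collapsed at time \<open>t\<close> decreases with the initial size, the chain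
  started at \<open>m\<close> bounds the chain started at \<open>n\<close> from above. From below, the mean \<open>y\<^sub>t\<close> of the size
  minus one satisfies \<open>y\<^sub>t\<^sub>+\<^sub>1 \<le> y\<^sub>t - y\<^sub>t\<^sup>2 / (3 n)\<close> by Jensen's inequality, so \<open>y\<^sub>t \<le> 3 n / (t + 2)\<close>: after
  \<open>\<epsilon> n\<close> steps the size is at most \<open>m\<close> up to probability \<open>O (1 / (\<epsilon> m))\<close>. Letting \<open>n\<close>, then \<open>m\<close>
  tend to infinity and then \<open>\<epsilon>\<close> to zero gives the limit \<open>\<Sum>k\<ge>1. (-1)^(k - 1) (2 k - 1) exp (- x (k choose 2))\<close>.

  Its derivative is the given density. The limit is monotone and lies between \<open>0\<close> and \<open>1 - exp (- x)\<close>
  (two starting points), which yields integrability of the density near \<open>0\<close>, where the series does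
  not converge absolutely uniformly, and the value of the integral.
\<close>

section \<open>The occupancy chain\<close>

text \<open>
  States are shifted by one: state \<open>j\<close> stands for \<open>j + 1\<close> occupied boxes, so that the absorbing
  state is \<open>0\<close>. One more ball hits an occupied box with probability \<open>(j + 1) / n\<close>; iterating this
  from one ball, \<open>image_mean n h i\<close> is the mean of \<open>h\<close> after throwing \<open>i + 1\<close> balls.
\<close>

definition throw_ball :: "nat \<Rightarrow> (nat \<Rightarrow> real) \<Rightarrow> nat \<Rightarrow> real" where
  "throw_ball n h j = real (Suc j) / real n * h j + (1 - real (Suc j) / real n) * h (Suc j)"

fun image_mean :: "nat \<Rightarrow> (nat \<Rightarrow> real) \<Rightarrow> nat \<Rightarrow> real" where
  "image_mean n h 0 = h 0"
| "image_mean n h (Suc i) = image_mean n (throw_ball n h) i"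

lemma throw_ball_linear:
  "throw_ball n (\<lambda>j. a * h j + b * h' j) = (\<lambda>j. a * throw_ball n h j + b * throw_ball n h' j)"
  by (simp add: throw_ball_def algebra_simps fun_eq_iff)

lemma throw_ball_const: "throw_ball n (\<lambda>_. c) = (\<lambda>_. c)"
  by (simp add: throw_ball_def algebra_simps fun_eq_iff)

lemma throw_ball_mono:
  assumes "Suc j \<le> n" "h j \<le> h' j" "h (Suc j) \<le> h' (Suc j)"
  shows "throw_ball n h j \<le> throw_ball n h' j"
  unfolding throw_ball_def using assms
  by (intro add_mono mult_left_mono) auto

lemma throw_ball_le_self:
  assumes "Suc j \<le> n" "h (Suc j) \<le> h j"
  shows "throw_ball n h j \<le> h j"
proof -
  have "throw_ball n h j = h j + (1 - real (Suc j) / real n) * (h (Suc j) - h j)"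
    unfolding throw_ball_def by algebra
  moreover have "(1 - real (Suc j) / real n) * (h (Suc j) - h j) \<le> 0"
    using assms by (intro mult_nonneg_nonpos) auto
  ultimately show ?thesis by simp
qed

lemma image_mean_linear:
  "image_mean n (\<lambda>j. a * h j + b * h' j) i = a * image_mean n h i + b * image_mean n h' i"
  by (induction i arbitrary: h h') (simp_all add: throw_ball_linear)

lemma image_mean_const: "image_mean n (\<lambda>_. c) i = c"
  by (induction i) (simp_all add: throw_ball_const)

lemma image_mean_mono:
  assumes "i < n" "\<And>j. j \<le> i \<Longrightarrow> h j \<le> h' j"
  shows "image_mean n h i \<le> image_mean n h' i"
  using assms
proof (induction i arbitrary: h h')
  case (Suc i)
  have "throw_ball n h j \<le> throw_ball n h' j" if "j \<le> i" for j
    using Suc.prems that by (intro throw_ball_mono) auto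
  with Suc.IH[of "throw_ball n h" "throw_ball n h'"] Suc.prems(1) show ?case by simp
qed simp

text \<open>The extra ball is thrown last: by definition \<open>image_mean n h (Suc i)\<close>
  averages \<open>throw_ball n h\<close> over the same \<open>i + 1\<close> balls, and one more
  throw can only move the state up, which lowers a decreasing \<open>h\<close>.\<close>

lemma image_mean_antimono:
  assumes "Suc i < n" "\<And>j. j \<le> i \<Longrightarrow> h (Suc j) \<le> h j"
  shows "image_mean n h (Suc i) \<le> image_mean n h i"
proof -
  have "image_mean n (throw_ball n h) i \<le> image_mean n h i"
    using assms by (intro image_mean_mono throw_ball_le_self) auto
  then show ?thesis by simp
qed

text \<open>Averaging is a contraction in the sup norm over the states up to \<open>i\<close>. This
  stability lets one-step errors simply add up in \<open>image_iter_coalescent_cdf\<close>.\<close>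

lemma image_mean_dist:
  assumes "i < n" "\<And>j. j \<le> i \<Longrightarrow> \<bar>h j - h' j\<bar> \<le> e"
  shows "\<bar>image_mean n h i - image_mean n h' i\<bar> \<le> e"
proof -
  have h: "h j \<le> 1 * h' j + 1 * e \<and> h' j \<le> 1 * h j + 1 * e" if "j \<le> i" for j
    using assms(2)[OF that] by auto
  have "image_mean n h i \<le> image_mean n (\<lambda>j. 1 * h' j + 1 * e) i"
    using assms(1) h by (intro image_mean_mono) auto
  moreover have "image_mean n h' i \<le> image_mean n (\<lambda>j. 1 * h j + 1 * e) i"
    using assms(1) h by (intro image_mean_mono) auto
  ultimately show ?thesis
    unfolding image_mean_linear image_mean_const by simp
qed

section \<open>Iteration in time\<close>

abbreviation image_iter :: "nat \<Rightarrow> nat \<Rightarrow> (nat \<Rightarrow> real) \<Rightarrow> nat \<Rightarrow> real" where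
  "image_iter n t \<equiv> image_mean n ^^ t"

lemma image_iter_linear:
  "image_iter n t (\<lambda>j. a * h j + b * h' j) =
    (\<lambda>i. a * image_iter n t h i + b * image_iter n t h' i)"
  by (induction t) (simp_all add: image_mean_linear)

lemma image_iter_const: "image_iter n t (\<lambda>_. c) = (\<lambda>_. c)"
  by (induction t) (simp_all add: image_mean_const)

lemma image_iter_mono:
  assumes "i < n" "\<And>j. j < n \<Longrightarrow> h j \<le> h' j"
  shows "image_iter n t h i \<le> image_iter n t h' i"
  using assms(1)
proof (induction t arbitrary: i)
  case (Suc t)
  then show ?case by (auto intro!: image_mean_mono)
qed (use assms in auto)

lemma image_iter_antimono:
  assumes "Suc i < n" "\<And>j. Suc j < n \<Longrightarrow> h (Suc j) \<le> h j"
  shows "image_iter n t h (Suc i) \<le> image_iter n t h i"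
  using assms(1)
proof (induction t arbitrary: i)
  case (Suc t)
  have "image_mean n (image_iter n t h) (Suc i) \<le> image_mean n (image_iter n t h) i"
    using Suc by (intro image_mean_antimono) auto
  then show ?case by simp
qed (use assms in auto)

text \<open>Jensen's inequality for the square: the variance, the mean of
  \<open>(h j - c)\<^sup>2\<close> around the mean \<open>c\<close>, is nonnegative, and linearity
  expands it.\<close>

lemma image_iter_power2_le:
  assumes "i < n"
  shows "(image_iter n t h i)\<^sup>2 \<le> image_iter n t (\<lambda>j. (h j)\<^sup>2) i"
proof -
  define c where "c = image_iter n t h i"
  have "0 \<le> image_iter n t (\<lambda>j. (h j - c)\<^sup>2) i"
    using image_iter_mono[OF assms, of "\<lambda>_. 0" "\<lambda>j. (h j - c)\<^sup>2" t] by (simp add: image_iter_const)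
  also have "(\<lambda>j. (h j - c)\<^sup>2) = (\<lambda>j. 1 * (h j)\<^sup>2 + 1 * ((- 2 * c) * h j + c\<^sup>2 * 1))"
    by (simp add: power2_eq_square algebra_simps)
  also have "image_iter n t \<dots> i = image_iter n t (\<lambda>j. (h j)\<^sup>2) i - c\<^sup>2"
    unfolding image_iter_linear image_iter_const
    by (simp add: c_def[symmetric] power2_eq_square)
  finally show ?thesis by (simp add: c_def)
qed

section \<open>Decay of the mean size\<close>

lemma throw_ball_real:
  "throw_ball n real = (\<lambda>j. (1 - 1 / n) * real j + (1 - 1 / n) * 1)"
  by (simp add: throw_ball_def fun_eq_iff add_divide_distrib algebra_simps)

lemma image_mean_real_Suc:
  "image_mean n real (Suc i) = (1 - 1 / n) * (image_mean n real i + 1)"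
proof -
  have "image_mean n real (Suc i) = image_mean n (\<lambda>j. (1 - 1 / n) * real j + (1 - 1 / n) * 1) i"
    by (simp only: image_mean.simps throw_ball_real)
  also have "\<dots> = (1 - 1 / n) * (image_mean n real i + 1)"
    unfolding image_mean_linear image_mean_const by (simp add: algebra_simps)
  finally show ?thesis .
qed

text \<open>Induction along the exact recursion for the mean; the slack of the step is displayed
  explicitly and is nonnegative because \<open>i \<le> n\<close>. The merge rate would suggest the
  constant 2 in place of 3, but for \<open>i\<close> near \<open>n\<close> the mean is about
  \<open>(1 - 1/e) n\<close>, which exceeds \<open>n / 2\<close>.\<close>

lemma image_mean_real_le:
  assumes "i < n"
  shows "image_mean n real i \<le> real i - (real i)\<^sup>2 / (3 * n)"
  using assms
proof (induction i)
  case (Suc i)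
  have n: "real n > 0" "real i \<le> n" "real n \<ge> 1" using Suc.prems by auto
  have "image_mean n real (Suc i) \<le> (1 - 1 / n) * (real i - (real i)\<^sup>2 / (3 * n) + 1)"
    unfolding image_mean_real_Suc using Suc n by (intro mult_left_mono) auto
  also have "\<dots> = real (Suc i) - (real (Suc i))\<^sup>2 / (3 * n) - (real i * (n - i) + 2 * n) / (3 * (real n)\<^sup>2)"
    using n by (simp add: field_simps power2_eq_square)
  also have "\<dots> \<le> real (Suc i) - (real (Suc i))\<^sup>2 / (3 * n)"
    using n by simp
  finally show ?case .
qed simp

text \<open>Discrete form of the differential inequality
  \<open>y' \<le> - y\<^sup>2 / (3 n)\<close>, whose solutions stay below \<open>3 n / t\<close>.
  The shift by 2 makes the bound true at \<open>t = 0\<close> and keeps it in the range where the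
  step map is increasing.\<close>

lemma image_iter_real_le:
  assumes "n \<ge> 1"
  shows "image_iter n t real (n - 1) \<le> 3 * n / (real t + 2)"
proof (induction t)
  case (Suc t)
  define y where "y = image_iter n t real (n - 1)"
  have n: "real n > 0" using assms by simp
  \<comment> \<open>The last time step is moved innermost, so that the one-step bound applies state
    by state and Jensen's inequality is used only for the remaining \<open>t\<close> steps.\<close>
  have "image_iter n (Suc t) real (n - 1) = image_iter n t (image_mean n real) (n - 1)"
    by (simp add: funpow_swap1)
  also have "\<dots> \<le> image_iter n t (\<lambda>j. 1 * real j + (- 1 / (3 * n)) * (real j)\<^sup>2) (n - 1)"
    using assms image_mean_real_le by (intro image_iter_mono) auto
  also have "\<dots> = y - image_iter n t (\<lambda>j. (real j)\<^sup>2) (n - 1) / (3 * n)"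
    unfolding image_iter_linear by (simp add: y_def)
  also have "\<dots> \<le> y - y\<^sup>2 / (3 * n)"
    using image_iter_power2_le[of "n - 1" n t real] assms by (auto simp: y_def divide_right_mono)
  also have "\<dots> \<le> 3 * n / (real (Suc t) + 2)"
  proof -
    define z where "z = y / (3 * n)"
    define c where "c = 1 / (real t + 2)"
    have z: "z \<le> c" using Suc n by (simp add: z_def y_def c_def field_simps)
    have c: "c \<le> 1 / 2" by (simp add: c_def)
    \<comment> \<open>The product equals \<open>(c - c\<^sup>2) - (z - z\<^sup>2)\<close>: the map
      \<open>z - z\<^sup>2\<close> increases up to \<open>1 / 2\<close>, and
      \<open>z \<le> c \<le> 1 / 2\<close>.\<close>
    have "0 \<le> (c - z) * (1 - c - z)" using z c by (intro mult_nonneg_nonneg) auto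
    then have "z - z\<^sup>2 \<le> c - c\<^sup>2" by (simp add: algebra_simps power2_eq_square)
    also have "\<dots> = (real t + 1) / (real t + 2)\<^sup>2"
      by (simp add: c_def divide_simps power2_eq_square)
    also have "\<dots> \<le> 1 / (real t + 3)"
      by (simp add: divide_simps power2_eq_square) (simp add: algebra_simps)
    finally have "3 * n * (z - z\<^sup>2) \<le> 3 * n * (1 / (real t + 3))" using n by (intro mult_left_mono) auto
    moreover have "3 * n * (z - z\<^sup>2) = y - y\<^sup>2 / (3 * n)"
      using n by (simp add: z_def field_simps power2_eq_square)
    ultimately show ?thesis by (simp add: add.commute)
  qed
  finally show ?case by simp
qed simp

section \<open>Absorption probabilities of the coalescent\<close>

text \<open>This is \<open>Suc k choose 2\<close>, the rate at which \<open>k + 1\<close> blocks of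
  Kingman's coalescent merge.\<close>

definition merge_rate :: "nat \<Rightarrow> real" where
  "merge_rate k = real k * (real k + 1) / 2"

text \<open>
  In terms of unshifted indices (size \<open>i + 1\<close>, summation index \<open>k + 1\<close>) the coefficient is the quotient of
  the falling and the rising factorial of \<open>i + 1\<close> of length \<open>k + 1\<close>, and it vanishes for \<open>k > i\<close>.
\<close>

definition merge_coeff :: "nat \<Rightarrow> nat \<Rightarrow> real" where
  "merge_coeff i k = (\<Prod>l=1..k. (real (Suc i) - real l) / (real (Suc i) + real l))"

text \<open>Explicit solution, as verified below, of \<open>F\<^sub>i' = merge_rate i *
  (F\<^sub>i\<^sub>-\<^sub>1 - F\<^sub>i)\<close> with initial value 1 for \<open>i = 0\<close> and
  0 otherwise: the distribution function of the time at which \<open>i + 1\<close> blocks have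
  merged into one.\<close>

definition coalescent_cdf :: "nat \<Rightarrow> real \<Rightarrow> real" where
  "coalescent_cdf i x =
    (\<Sum>k\<le>i. (- 1) ^ k * (2 * real k + 1) * merge_coeff i k * exp (- merge_rate k * x))"

lemma merge_rate_nonneg: "0 \<le> merge_rate k"
  by (simp add: merge_rate_def)

text \<open>To first order in \<open>1 / n\<close> at most one collision occurs among
  \<open>i + 1\<close> balls. Ball number \<open>i + 2\<close> adds \<open>i + 1\<close> boxes to
  hit, which is \<open>merge_rate (Suc i) - merge_rate i\<close>; everything else is of second
  order, with \<open>K\<close> independent of \<open>n\<close>, \<open>h\<close> and
  \<open>M\<close>. At \<open>i = 0\<close> the truncated index \<open>i - 1\<close> is harmless
  since \<open>merge_rate 0 = 0\<close>.\<close>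

lemma image_mean_expansion:
  "\<exists>K. \<forall>n h M. i < n \<longrightarrow> (\<forall>j\<le>i. \<bar>h j\<bar> \<le> M) \<longrightarrow>
    \<bar>image_mean n h i - (h i + merge_rate i / n * (h (i - 1) - h i))\<bar> \<le> K * M / (real n)\<^sup>2"
proof (induction i)
  case 0
  show ?case by (intro exI[of _ 0]) simp
next
  case (Suc i)
  then obtain K where K: "\<And>n h M. i < n \<Longrightarrow> (\<And>j. j \<le> i \<Longrightarrow> \<bar>h j\<bar> \<le> M) \<Longrightarrow>
    \<bar>image_mean n h i - (h i + merge_rate i / n * (h (i - 1) - h i))\<bar> \<le> K * M / (real n)\<^sup>2"
    by blast
  have "\<bar>image_mean n h (Suc i) - (h (Suc i) + merge_rate (Suc i) / n * (h (Suc i - 1) - h (Suc i)))\<bar>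
      \<le> (K + merge_rate i * (4 * i + 2)) * M / (real n)\<^sup>2"
    if n: "Suc i < n" and M: "\<forall>j\<le>Suc i. \<bar>h j\<bar> \<le> M" for n h M
  proof -
    let ?g = "throw_ball n h"
    have g: "\<bar>?g j\<bar> \<le> M" if "j \<le> i" for j
    proof -
      have "?g j \<le> throw_ball n (\<lambda>_. M) j" "throw_ball n (\<lambda>_. - M) j \<le> ?g j"
        using n that M[rule_format, of j] M[rule_format, of "Suc j"] by (intro throw_ball_mono; simp add: abs_le_iff)+
      then show ?thesis by (simp add: throw_ball_const)
    qed
    \<comment> \<open>Inserting \<open>throw_ball\<close> at \<open>i\<close> and
      \<open>i - 1\<close> reproduces the first-order formula for \<open>Suc i\<close>, with an
      exact remainder carrying the factor \<open>1 / n\<^sup>2\<close>.\<close>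
    have eq: "?g i + merge_rate i / n * (?g (i - 1) - ?g i)
        = h (Suc i) + merge_rate (Suc i) / n * (h i - h (Suc i))
          + merge_rate i / (real n)\<^sup>2 * (i * (h (i - 1) - h i) - (real i + 1) * (h i - h (Suc i)))"
    proof (cases i)
      case 0
      then show ?thesis using n by (simp add: throw_ball_def merge_rate_def field_simps)
    next
      case (Suc i')
      then show ?thesis using n
        by (simp add: throw_ball_def merge_rate_def divide_simps power2_eq_square)
          (simp add: algebra_simps)
    qed
    have d: "\<bar>h (i - 1) - h i\<bar> \<le> 2 * M" "\<bar>h i - h (Suc i)\<bar> \<le> 2 * M"
      using M[rule_format, of i] M[rule_format, of "Suc i"] M[rule_format, of "i - 1", OF le_SucI[OF diff_le_self]]
      by auto
    have "\<bar>i * (h (i - 1) - h i) - (real i + 1) * (h i - h (Suc i))\<bar>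
        \<le> \<bar>i * (h (i - 1) - h i)\<bar> + \<bar>(real i + 1) * (h i - h (Suc i))\<bar>"
      by simp
    also have "\<dots> \<le> i * (2 * M) + (real i + 1) * (2 * M)"
      unfolding abs_mult using d by (intro add_mono mult_mono) auto
    finally have "\<bar>merge_rate i / (real n)\<^sup>2 * (i * (h (i - 1) - h i) - (real i + 1) * (h i - h (Suc i)))\<bar>
        \<le> merge_rate i / (real n)\<^sup>2 * (i * (2 * M) + (real i + 1) * (2 * M))"
      using merge_rate_nonneg[of i]
      by (subst abs_mult) (auto intro!: mult_left_mono divide_right_mono)
    also have "\<dots> = merge_rate i * (4 * i + 2) * M / (real n)\<^sup>2"
      by (simp add: algebra_simps add_divide_distrib)
    finally have "\<bar>merge_rate i / (real n)\<^sup>2 * (i * (h (i - 1) - h i) - (real i + 1) * (h i - h (Suc i)))\<bar>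
        \<le> merge_rate i * (4 * i + 2) * M / (real n)\<^sup>2" .
    moreover have "\<bar>image_mean n ?g i - (?g i + merge_rate i / n * (?g (i - 1) - ?g i))\<bar> \<le> K * M / (real n)\<^sup>2"
      using n g by (intro K) auto
    moreover have "\<bar>a - b\<bar> \<le> p + q" if "\<bar>e\<bar> \<le> q" "\<bar>a - (b + e)\<bar> \<le> p" for a b e p q :: real
      using that by linarith
    ultimately have "\<bar>image_mean n ?g i - (h (Suc i) + merge_rate (Suc i) / n * (h i - h (Suc i)))\<bar>
        \<le> K * M / (real n)\<^sup>2 + merge_rate i * (4 * i + 2) * M / (real n)\<^sup>2"
      unfolding eq by blast
    then show ?thesis
      by (simp add: add_divide_distrib distrib_right)
  qed
  then show ?case by blast
qed

section \<open>Coefficients of the explicit solution\<close>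

lemma merge_coeff_0: "merge_coeff i 0 = 1"
  by (simp add: merge_coeff_def)

lemma merge_coeff_Suc:
  "merge_coeff i (Suc k) = merge_coeff i k * (real i - real k) / (real i + real k + 2)"
  by (simp add: merge_coeff_def prod.nat_ivl_Suc' algebra_simps)

lemma merge_coeff_eq_0: "i < k \<Longrightarrow> merge_coeff i k = 0"
  unfolding merge_coeff_def by (rule prod_zero) (auto intro!: bexI[of _ "Suc i"])

lemma merge_coeff_nonneg: "0 \<le> merge_coeff i k"
proof (cases "k \<le> i")
  case True
  then show ?thesis by (auto simp: merge_coeff_def intro!: prod_nonneg)
qed (simp add: merge_coeff_eq_0)

lemma merge_coeff_le_1: "merge_coeff i k \<le> 1"
proof (cases "k \<le> i")
  case True
  then show ?thesis by (auto simp: merge_coeff_def intro!: prod_le_1)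
qed (simp add: merge_coeff_eq_0)

text \<open>Ratio of the coefficients of neighbouring states, cleared of denominators so that it
  also covers the vanishing coefficients for \<open>k > i\<close>.\<close>

lemma merge_coeff_recurrence:
  "merge_coeff i k * real (Suc i) * (real i + 2)
    = merge_coeff (Suc i) k * (real i + 1 - real k) * (real i + real k + 2)"
proof (induction k)
  case 0
  show ?case by (simp add: merge_coeff_0)
next
  case (Suc k)
  have "merge_coeff i (Suc k) * real (Suc i) * (real i + 2)
      = (merge_coeff i k * real (Suc i) * (real i + 2)) * (real i - real k) / (real i + real k + 2)"
    by (simp add: merge_coeff_Suc)
  also have "\<dots> = merge_coeff (Suc i) k * (real i + 1 - real k) * (real i - real k)"
    unfolding Suc.IH by (simp add: add_eq_0_iff2 add.commute)
  also have "\<dots> = merge_coeff (Suc i) (Suc k) * (real i + 1 - real (Suc k)) * (real i + real (Suc k) + 2)"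
    by (simp add: merge_coeff_Suc divide_simps)
  finally show ?case .
qed

text \<open>For fixed \<open>k\<close> the coefficients, as a function of the state, form an
  eigenvector of the coalescent generator with eigenvalue \<open>- merge_rate k\<close>. The algebra
  behind it is \<open>(i + 1) (i + 2) - k (k + 1) = (i + 1 - k) (i + k + 2)\<close>.\<close>

lemma merge_rate_coeff:
  "merge_rate (Suc i) * (merge_coeff i k - merge_coeff (Suc i) k) = - merge_rate k * merge_coeff (Suc i) k"
  using merge_coeff_recurrence[of i k] by (simp add: merge_rate_def field_simps)

lemma coalescent_cdf_extend:
  assumes "i \<le> m"
  shows "coalescent_cdf i x =
    (\<Sum>k\<le>m. (- 1) ^ k * (2 * real k + 1) * merge_coeff i k * exp (- merge_rate k * x))"
  unfolding coalescent_cdf_def using assms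
  by (intro sum.mono_neutral_left) (auto simp: merge_coeff_eq_0)

text \<open>The right-hand side is the termwise derivative of \<open>coalescent_cdf i\<close>, so
  this is the differential equation; it holds mode by mode by the eigenvector property.\<close>

lemma coalescent_cdf_ode:
  "merge_rate i * (coalescent_cdf (i - 1) x - coalescent_cdf i x) =
    (\<Sum>k\<le>i. (- 1) ^ k * (2 * real k + 1) * merge_coeff i k * exp (- merge_rate k * x) * (- merge_rate k))"
proof (cases i)
  case 0
  then show ?thesis by (simp add: merge_rate_def)
next
  case (Suc i')
  have "merge_rate i * (coalescent_cdf (i - 1) x - coalescent_cdf i x) =
    (\<Sum>k\<le>i. (- 1) ^ k * (2 * real k + 1) * exp (- merge_rate k * x)
      * (merge_rate i * (merge_coeff i' k - merge_coeff i k)))"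
    unfolding coalescent_cdf_extend[OF order_refl, of i] coalescent_cdf_extend[of "i - 1" i, OF diff_le_self]
      sum_subtractf[symmetric] sum_distrib_left
    by (intro sum.cong refl) (simp add: Suc algebra_simps)
  also have "\<dots> = (\<Sum>k\<le>i. (- 1) ^ k * (2 * real k + 1) * merge_coeff i k * exp (- merge_rate k * x) * (- merge_rate k))"
    unfolding Suc merge_rate_coeff by (intro sum.cong) auto
  finally show ?thesis .
qed

lemma coalescent_cdf_at_0: "coalescent_cdf i 0 = (if i = 0 then 1 else 0)"
proof (cases "i = 0")
  case True
  then show ?thesis by (simp add: coalescent_cdf_def merge_coeff_0 merge_rate_def)
next
  case False
  \<comment> \<open>a primitive of the alternating sum: \<open>(2 k + 1) a\<^sub>k = b\<^sub>k + b\<^sub>k\<^sub>+\<^sub>1\<close>\<close>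
  define b where "b k = merge_coeff i k * (real i + 1 + real k) * real k / real i" for k
  have b: "(2 * real k + 1) * merge_coeff i k = b k + b (Suc k)" for k
    using False by (simp add: b_def merge_coeff_Suc divide_simps) (simp add: algebra_simps)
  have "(\<Sum>k<N. (- 1) ^ k * (2 * real k + 1) * merge_coeff i k) = - ((- 1) ^ N * b N)" for N
  proof (induction N)
    case (Suc N)
    have "(\<Sum>k<Suc N. (- 1) ^ k * (2 * real k + 1) * merge_coeff i k)
        = - ((- 1) ^ N * b N) + (- 1) ^ N * ((2 * real N + 1) * merge_coeff i N)"
      using Suc by simp
    then show ?case unfolding b by (simp add: algebra_simps)
  qed (simp add: b_def)
  \<comment> \<open>At \<open>N = i + 1\<close> the boundary term \<open>b N\<close> vanishes
    together with \<open>merge_coeff i (Suc i)\<close>.\<close>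
  from this[of "Suc i"] show ?thesis
    using False by (simp add: coalescent_cdf_def lessThan_Suc_atMost b_def merge_coeff_eq_0)
qed

section \<open>A small time step of the explicit solution\<close>

lemma exp_minus_quadratic_bound:
  assumes "0 \<le> (u::real)"
  shows "\<bar>exp (- u) - 1 + u\<bar> \<le> u\<^sup>2"
proof -
  have "exp (- u) \<le> 1 / (1 + u)"
    using exp_ge_add_one_self[of u] assms by (simp add: exp_minus field_simps)
  also have "\<dots> \<le> 1 - u + u\<^sup>2"
    using assms by (simp add: field_simps power2_eq_square)
  finally show ?thesis using exp_ge_add_one_self[of "- u"] by auto
qed

lemma coalescent_cdf_bounded:
  assumes "0 \<le> x"
  shows "\<bar>coalescent_cdf i x\<bar> \<le> (\<Sum>k\<le>i. 2 * real k + 1)"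
  unfolding coalescent_cdf_def
proof (rule order_trans[OF sum_abs sum_mono])
  fix k
  have "merge_coeff i k * exp (- merge_rate k * x) \<le> 1 * 1"
    using assms merge_rate_nonneg[of k] merge_coeff_nonneg[of i k]
    by (intro mult_mono merge_coeff_le_1) auto
  then show "\<bar>(- 1) ^ k * (2 * real k + 1) * merge_coeff i k * exp (- merge_rate k * x)\<bar> \<le> 2 * real k + 1"
    using merge_coeff_nonneg[of i k] by (simp add: abs_mult mult_left_le mult.assoc)
qed

text \<open>First-order Taylor expansion with an error uniform in \<open>x\<close>: each exponential
  mode contributes a factor \<open>exp (- merge_rate k * x)\<close>, at most 1, times a quadratic
  error in \<open>h\<close>.\<close>

lemma coalescent_cdf_step:
  "\<exists>K. \<forall>x\<ge>0. \<forall>h\<ge>0. \<bar>coalescent_cdf i (x + h) - (coalescent_cdf i x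
      + h * (merge_rate i * (coalescent_cdf (i - 1) x - coalescent_cdf i x)))\<bar> \<le> K * h\<^sup>2"
proof (intro exI allI impI)
  fix x h :: real assume x: "0 \<le> x" and h: "0 \<le> h"
  have eq: "coalescent_cdf i (x + h) - (coalescent_cdf i x
      + h * (merge_rate i * (coalescent_cdf (i - 1) x - coalescent_cdf i x)))
    = (\<Sum>k\<le>i. (- 1) ^ k * (2 * real k + 1) * merge_coeff i k * exp (- merge_rate k * x) *
        (exp (- (merge_rate k * h)) - 1 + merge_rate k * h))"
    unfolding coalescent_cdf_ode
    unfolding coalescent_cdf_def sum_distrib_left sum.distrib[symmetric] sum_subtractf[symmetric]
  proof (intro sum.cong refl)
    fix k
    have gen: "c * (A * B) - (c * A + h * (c * A * - r)) = c * A * (B - 1 + r * h)" for c A B r :: real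
      by (simp add: algebra_simps)
    have E: "exp (- merge_rate k * (x + h)) = exp (- merge_rate k * x) * exp (- (merge_rate k * h))"
      by (simp add: exp_add[symmetric] algebra_simps)
    show "(- 1) ^ k * (2 * real k + 1) * merge_coeff i k * exp (- merge_rate k * (x + h)) -
        ((- 1) ^ k * (2 * real k + 1) * merge_coeff i k * exp (- merge_rate k * x) +
         h * ((- 1) ^ k * (2 * real k + 1) * merge_coeff i k * exp (- merge_rate k * x) * - merge_rate k))
      = (- 1) ^ k * (2 * real k + 1) * merge_coeff i k * exp (- merge_rate k * x) *
        (exp (- (merge_rate k * h)) - 1 + merge_rate k * h)"
      unfolding E by (rule gen)
  qed
  have "\<bar>\<Sum>k\<le>i. (- 1) ^ k * (2 * real k + 1) * merge_coeff i k * exp (- merge_rate k * x) *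
        (exp (- (merge_rate k * h)) - 1 + merge_rate k * h)\<bar> \<le> (\<Sum>k\<le>i. (2 * real k + 1) * (merge_rate k)\<^sup>2 * h\<^sup>2)"
  proof (rule order_trans[OF sum_abs sum_mono])
    fix k
    let ?e = "exp (- (merge_rate k * h)) - 1 + merge_rate k * h"
    have "merge_coeff i k * exp (- merge_rate k * x) \<le> 1 * 1"
      using x merge_rate_nonneg[of k] merge_coeff_nonneg[of i k]
      by (intro mult_mono merge_coeff_le_1) auto
    moreover have "\<bar>?e\<bar> \<le> (merge_rate k * h)\<^sup>2"
      using h merge_rate_nonneg[of k] by (intro exp_minus_quadratic_bound) simp
    ultimately have "(merge_coeff i k * exp (- merge_rate k * x)) * \<bar>?e\<bar> \<le> 1 * (merge_rate k * h)\<^sup>2"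
      using merge_coeff_nonneg[of i k] by (intro mult_mono) auto
    then have "(2 * real k + 1) * ((merge_coeff i k * exp (- merge_rate k * x)) * \<bar>?e\<bar>)
        \<le> (2 * real k + 1) * (1 * (merge_rate k * h)\<^sup>2)"
      by (intro mult_left_mono) auto
    then show "\<bar>(- 1) ^ k * (2 * real k + 1) * merge_coeff i k * exp (- merge_rate k * x) * ?e\<bar>
        \<le> (2 * real k + 1) * (merge_rate k)\<^sup>2 * h\<^sup>2"
      using merge_coeff_nonneg[of i k] by (simp add: abs_mult mult.assoc power_mult_distrib)
  qed
  also have "\<dots> = (\<Sum>k\<le>i. (2 * real k + 1) * (merge_rate k)\<^sup>2) * h\<^sup>2"
    by (rule sum_distrib_right[symmetric])
  finally show "\<bar>coalescent_cdf i (x + h) - (coalescent_cdf i x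
      + h * (merge_rate i * (coalescent_cdf (i - 1) x - coalescent_cdf i x)))\<bar>
      \<le> (\<Sum>k\<le>i. (2 * real k + 1) * (merge_rate k)\<^sup>2) * h\<^sup>2"
    unfolding eq .
qed

section \<open>Comparison of the chain with the coalescent for bounded initial size\<close>

definition collapsed :: "nat \<Rightarrow> real" where
  "collapsed j = (if j = 0 then 1 else 0)"

text \<open>One step of the chain matches a time step \<open>1 / n\<close> of the coalescent: both
  expansions have the same first-order term, so only errors of order \<open>1 / n\<^sup>2\<close>
  remain.\<close>

lemma image_mean_coalescent_cdf:
  "\<exists>K. \<forall>n x. i < n \<longrightarrow> 0 \<le> x \<longrightarrow>
    \<bar>image_mean n (\<lambda>j. coalescent_cdf j x) i - coalescent_cdf i (x + 1 / n)\<bar> \<le> K / (real n)\<^sup>2"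
proof -
  obtain K1 where K1: "\<And>n h M. i < n \<Longrightarrow> (\<And>j. j \<le> i \<Longrightarrow> \<bar>h j\<bar> \<le> M) \<Longrightarrow>
    \<bar>image_mean n h i - (h i + merge_rate i / n * (h (i - 1) - h i))\<bar> \<le> K1 * M / (real n)\<^sup>2"
    using image_mean_expansion[of i] by blast
  obtain K2 where K2: "\<And>x h. 0 \<le> x \<Longrightarrow> 0 \<le> h \<Longrightarrow> \<bar>coalescent_cdf i (x + h) - (coalescent_cdf i x
      + h * (merge_rate i * (coalescent_cdf (i - 1) x - coalescent_cdf i x)))\<bar> \<le> K2 * h\<^sup>2"
    using coalescent_cdf_step[of i] by blast
  define M where "M = (\<Sum>k\<le>i. 2 * real k + 1)"
  have "\<bar>image_mean n (\<lambda>j. coalescent_cdf j x) i - coalescent_cdf i (x + 1 / n)\<bar>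
      \<le> (K1 * M + K2) / (real n)\<^sup>2" if "i < n" "0 \<le> x" for n x
  proof -
    have "\<bar>coalescent_cdf j x\<bar> \<le> M" if "j \<le> i" for j
      unfolding M_def using that
      by (intro order_trans[OF coalescent_cdf_bounded[OF \<open>0 \<le> x\<close>]] sum_mono2) auto
    then have "\<bar>image_mean n (\<lambda>j. coalescent_cdf j x) i - (coalescent_cdf i x
        + merge_rate i / n * (coalescent_cdf (i - 1) x - coalescent_cdf i x))\<bar> \<le> K1 * M / (real n)\<^sup>2"
      using that by (intro K1) auto
    moreover have "\<bar>coalescent_cdf i (x + 1 / n) - (coalescent_cdf i x
        + 1 / n * (merge_rate i * (coalescent_cdf (i - 1) x - coalescent_cdf i x)))\<bar> \<le> K2 / (real n)\<^sup>2"
      using K2[of x "1 / n"] that by (simp add: power_divide)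
    ultimately show ?thesis by (simp add: add_divide_distrib abs_le_iff)
  qed
  then show ?thesis by blast
qed

text \<open>The one-step errors accumulate linearly because \<open>image_mean\<close> is a
  contraction. A single \<open>K\<close> serves all states up to \<open>m\<close>, since the chain
  never leaves them; for \<open>t\<close> of order \<open>n\<close> the total error is of order
  \<open>1 / n\<close>.\<close>

lemma image_iter_coalescent_cdf:
  "\<exists>K. \<forall>n t i. i \<le> m \<longrightarrow> m < n \<longrightarrow>
    \<bar>image_iter n t collapsed i - coalescent_cdf i (t / n)\<bar> \<le> t * (K / (real n)\<^sup>2)"
proof -
  have "\<exists>K. \<forall>i. \<forall>n x. i < n \<longrightarrow> 0 \<le> x \<longrightarrow>
    \<bar>image_mean n (\<lambda>j. coalescent_cdf j x) i - coalescent_cdf i (x + 1 / n)\<bar> \<le> K i / (real n)\<^sup>2"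
    using image_mean_coalescent_cdf by (intro choice) blast
  then obtain K0 where K0: "\<And>i n x. i < n \<Longrightarrow> 0 \<le> x \<Longrightarrow>
    \<bar>image_mean n (\<lambda>j. coalescent_cdf j x) i - coalescent_cdf i (x + 1 / n)\<bar> \<le> K0 i / (real n)\<^sup>2"
    by blast
  define K where "K = Max (K0 ` {..m})"
  have "\<bar>image_iter n t collapsed i - coalescent_cdf i (t / n)\<bar> \<le> t * (K / (real n)\<^sup>2)"
    if "i \<le> m" "m < n" for n t i
    using that(1)
  proof (induction t arbitrary: i)
    case 0
    then show ?case by (simp add: collapsed_def coalescent_cdf_at_0)
  next
    case (Suc t)
    have i: "i < n" using Suc.prems that by simp
    have "\<bar>image_mean n (image_iter n t collapsed) i - image_mean n (\<lambda>j. coalescent_cdf j (t / n)) i\<bar>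
        \<le> t * (K / (real n)\<^sup>2)"
      using i Suc.prems by (intro image_mean_dist Suc.IH) auto
    moreover have "\<bar>image_mean n (\<lambda>j. coalescent_cdf j (t / n)) i - coalescent_cdf i (t / n + 1 / n)\<bar>
        \<le> K0 i / (real n)\<^sup>2"
      using i by (intro K0) auto
    moreover have "K0 i / (real n)\<^sup>2 \<le> K / (real n)\<^sup>2"
      using Suc.prems by (auto simp: K_def intro!: divide_right_mono)
    moreover have "t / n + 1 / n = real (Suc t) / n" by (simp add: add_divide_distrib)
    moreover have "real (Suc t) * (K / (real n)\<^sup>2) = t * (K / (real n)\<^sup>2) + K / (real n)\<^sup>2"
      by (simp add: algebra_simps add_divide_distrib)
    ultimately show ?case by simp
  qed
  then show ?thesis by blast
qed

section \<open>The series of the limit law\<close>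

lemma merge_rate_ge: "real k \<le> merge_rate k"
proof (cases k)
  case (Suc j)
  then show ?thesis by (simp add: merge_rate_def field_simps)
qed (simp add: merge_rate_def)

lemma summable_power_exp_merge_rate:
  assumes "0 < x"
  shows "summable (\<lambda>k. (2 * real k + 1) ^ 5 * exp (- merge_rate k * x))"
proof (rule summable_comparison_test)
  show "summable (\<lambda>k. 3 ^ 5 * (8 / x) ^ 8 * inverse (real k ^ 3))"
    by (intro summable_mult inverse_power_summable) auto
  show "\<exists>N. \<forall>k\<ge>N. norm ((2 * real k + 1) ^ 5 * exp (- merge_rate k * x))
      \<le> 3 ^ 5 * (8 / x) ^ 8 * inverse (real k ^ 3)"
  proof (intro exI[of _ 1] allI impI)
    fix k :: nat assume k: "1 \<le> k"
    \<comment> \<open>Since \<open>merge_rate k * x \<ge> 8 * u\<close>, the exponential is at most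
      \<open>u\<close> to the power -8: five of these powers of \<open>k\<close> cancel the
      polynomial factor and three remain for summability.\<close>
    define u where "u = real k * x / 8"
    have u: "0 < u" using k assms by (simp add: u_def)
    have "u \<le> exp u" using exp_ge_add_one_self[of u] by linarith
    then have inv: "inverse (exp u ^ 8) \<le> inverse (u ^ 8)"
      using u by (intro le_imp_inverse_le power_mono) auto
    have "exp (- merge_rate k * x) \<le> exp (- (8 * u))"
      using merge_rate_ge[of k] assms by (simp add: u_def mult_right_mono)
    also have "\<dots> = inverse (exp u ^ 8)"
      by (simp add: exp_minus exp_of_nat_mult[symmetric])
    also note inv
    finally have "exp (- merge_rate k * x) \<le> inverse (u ^ 8)" .
    moreover have "(2 * real k + 1) ^ 5 \<le> (3 * real k) ^ 5"
      using k by (intro power_mono) auto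
    ultimately have "(2 * real k + 1) ^ 5 * exp (- merge_rate k * x) \<le> (3 * real k) ^ 5 * inverse (u ^ 8)"
      by (intro mult_mono) auto
    also have "\<dots> = 3 ^ 5 * (8 / x) ^ 8 * inverse (real k ^ 3)"
      using k assms by (simp add: u_def field_simps eval_nat_numeral)
    finally show "norm ((2 * real k + 1) ^ 5 * exp (- merge_rate k * x))
      \<le> 3 ^ 5 * (8 / x) ^ 8 * inverse (real k ^ 3)"
      by simp
  qed
qed

lemma summable_exp_merge_rate:
  assumes "0 < x" "\<And>k. \<bar>c k\<bar> \<le> (2 * real k + 1) ^ 5"
  shows "summable (\<lambda>k. \<bar>c k * exp (- merge_rate k * x)\<bar>)"
    and "summable (\<lambda>k. c k * exp (- merge_rate k * x))"
proof -
  show "summable (\<lambda>k. \<bar>c k * exp (- merge_rate k * x)\<bar>)"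
    using assms(2)
    by (intro summable_comparison_test'[OF summable_power_exp_merge_rate[OF assms(1)], of 0])
      (auto simp: abs_mult intro!: mult_right_mono)
  then show "summable (\<lambda>k. c k * exp (- merge_rate k * x))"
    by (rule summable_rabs_cancel)
qed

lemma deriv_exp_merge_rate_series:
  assumes x: "0 < x" and c: "\<And>k. \<bar>c k\<bar> \<le> (2 * real k + 1) ^ 5"
    and c': "\<And>k. \<bar>c k * (- merge_rate k)\<bar> \<le> (2 * real k + 1) ^ 5"
  shows "((\<lambda>x. \<Sum>k. c k * exp (- merge_rate k * x)) has_real_derivative
    (\<Sum>k. c k * (- merge_rate k) * exp (- merge_rate k * x))) (at x)"
proof (rule has_field_derivative_series'(2)[of "{x/2<..}"])
  show "convex {x/2<..}" by simp
  show "((\<lambda>y. c k * exp (- merge_rate k * y)) has_real_derivative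
      c k * (- merge_rate k) * exp (- merge_rate k * y)) (at y within {x/2<..})" for k y
    by (auto intro!: derivative_eq_intros)
  show "uniformly_convergent_on {x/2<..} (\<lambda>n y. \<Sum>i<n. c i * (- merge_rate i) * exp (- merge_rate i * y))"
  proof (rule Weierstrass_m_test')
    show "summable (\<lambda>k. (2 * real k + 1) ^ 5 * exp (- merge_rate k * (x / 2)))"
      using x by (intro summable_power_exp_merge_rate) simp
    show "norm (c k * (- merge_rate k) * exp (- merge_rate k * y))
        \<le> (2 * real k + 1) ^ 5 * exp (- merge_rate k * (x / 2))" if "y \<in> {x/2<..}" for k y
    proof -
      have "merge_rate k * (x / 2) \<le> merge_rate k * y"
        using that merge_rate_nonneg[of k] by (intro mult_left_mono) auto
      then have "\<bar>c k * (- merge_rate k)\<bar> * exp (- merge_rate k * y)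
          \<le> (2 * real k + 1) ^ 5 * exp (- merge_rate k * (x / 2))"
        by (intro mult_mono c') auto
      then show ?thesis by (simp add: abs_mult)
    qed
  qed
  show "x \<in> {x/2<..}" using x by simp
  show "summable (\<lambda>k. c k * exp (- merge_rate k * x))"
    using x c by (rule summable_exp_merge_rate)
  show "x \<in> interior {x/2<..}" using x by (simp add: interior_open)
qed

text \<open>\<open>coalescent_cdf\<close> with every coefficient replaced by its limit 1: the
  coalescent started from infinitely many blocks.\<close>

definition full_coalescence_cdf :: "real \<Rightarrow> real" where
  "full_coalescence_cdf x = (\<Sum>k. (- 1) ^ k * (2 * real k + 1) * exp (- merge_rate k * x))"

text \<open>The coefficients of the series and of its first two formal derivatives; the second
  derivative serves to prove continuity of the density.\<close>

lemma merge_coeffs_bound: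
  "\<bar>(- 1) ^ k * (2 * real k + 1)\<bar> \<le> (2 * real k + 1) ^ 5"
  "\<bar>(- 1) ^ k * (2 * real k + 1) * (- merge_rate k)\<bar> \<le> (2 * real k + 1) ^ 5"
  "\<bar>(- 1) ^ k * (2 * real k + 1) * (- merge_rate k) * (- merge_rate k)\<bar> \<le> (2 * real k + 1) ^ 5"
proof -
  let ?a = "2 * real k + 1"
  have r: "merge_rate k \<le> ?a ^ 2" "0 \<le> merge_rate k"
    by (simp_all add: merge_rate_def power2_eq_square algebra_simps)
  have a: "1 \<le> ?a" by simp
  have "?a ^ 1 \<le> ?a ^ 5" using a by (rule power_increasing[rotated]) simp
  then show "\<bar>(- 1) ^ k * (2 * real k + 1)\<bar> \<le> ?a ^ 5" by (simp add: abs_mult)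
  have "?a * merge_rate k \<le> ?a * ?a ^ 2" using a r by (intro mult_left_mono) auto
  also have "\<dots> = ?a ^ 3" by (simp add: eval_nat_numeral)
  also have "\<dots> \<le> ?a ^ 5" using a by (rule power_increasing[rotated]) simp
  finally show "\<bar>(- 1) ^ k * (2 * real k + 1) * (- merge_rate k)\<bar> \<le> ?a ^ 5"
    using r by (simp add: abs_mult)
  have "?a * merge_rate k * merge_rate k \<le> ?a * ?a ^ 2 * ?a ^ 2"
    using a r by (intro mult_mono) auto
  also have "\<dots> = ?a ^ 5" by (simp add: eval_nat_numeral)
  finally show "\<bar>(- 1) ^ k * (2 * real k + 1) * (- merge_rate k) * (- merge_rate k)\<bar> \<le> ?a ^ 5"
    using r by (simp add: abs_mult)
qed

text \<open>The index is shifted by one, the sign change from the shift being absorbed into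
  \<open>- merge_rate k\<close>. The term \<open>k = 0\<close> vanishes, and absolute convergence
  for \<open>x > 0\<close> identifies the unordered sum with the series.\<close>

lemma limit_density_eq_suminf:
  assumes "0 < x"
  shows "limit_density x = (\<Sum>k. (- 1) ^ k * (2 * real k + 1) * (- merge_rate k) * exp (- merge_rate k * x))"
proof -
  let ?g = "\<lambda>k. (- 1) ^ k * (2 * real k + 1) * (- merge_rate k) * exp (- merge_rate k * x)"
  have s: "summable (\<lambda>k. \<bar>?g k\<bar>)" "summable ?g"
    using assms merge_coeffs_bound(2) by (rule summable_exp_merge_rate)+
  have "(?g has_sum suminf ?g) UNIV"
    using s by (intro norm_summable_imp_has_sum summable_sums) auto
  then have "(?g has_sum suminf ?g) {1..}"
    by (rule has_sum_cong_neutral[THEN iffD1, rotated -1]) (auto simp: merge_rate_def Suc_le_eq)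
  then have "infsum ?g {1..} = suminf ?g"
    by (rule infsumI)
  moreover have "limit_density x = infsum ?g {1..}"
    unfolding limit_density_def
  proof (rule infsum_reindex_bij_witness[where i = Suc and j = "\<lambda>k. k - 1"])
    fix k :: nat assume "k \<in> {2..}"
    then obtain j where j: "k = Suc j" "j \<ge> 1" by (cases k) auto
    have "real (k choose 2) = merge_rate j"
      unfolding j(1) by (simp add: merge_rate_def choose_two real_of_nat_div algebra_simps)
    then show "?g (k - 1) = (- 1) ^ k * exp (- x * real (k choose 2)) * (2 * real k - 1) * real (k choose 2)"
      using j by (simp add: algebra_simps)
  qed auto
  ultimately show ?thesis by simp
qed

lemma full_coalescence_cdf_deriv:
  assumes "0 < x"
  shows "(full_coalescence_cdf has_real_derivative limit_density x) (at x)"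
  unfolding limit_density_eq_suminf[OF assms] full_coalescence_cdf_def
  using assms merge_coeffs_bound(1,2) by (rule deriv_exp_merge_rate_series)

lemma isCont_limit_density:
  assumes "0 < x"
  shows "isCont limit_density x"
proof -
  let ?s = "\<lambda>x. \<Sum>k. (- 1) ^ k * (2 * real k + 1) * (- merge_rate k) * exp (- merge_rate k * x)"
  have "isCont ?s x"
    using deriv_exp_merge_rate_series[OF assms merge_coeffs_bound(2,3)] by (rule DERIV_isCont)
  moreover have "\<forall>\<^sub>F y in nhds x. limit_density y = ?s y"
    using eventually_nhds_in_open[of "{0<..}" x] assms
    by (auto elim!: eventually_mono simp: limit_density_eq_suminf)
  ultimately show ?thesis
    using isCont_cong[of limit_density ?s x] by blast
qed

lemma coalescent_cdf_tendsto:
  assumes "0 < x"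
  shows "(\<lambda>i. coalescent_cdf i x) \<longlonglongrightarrow> full_coalescence_cdf x"
proof -
  let ?a = "\<lambda>k i. (- 1) ^ k * (2 * real k + 1) * merge_coeff i k * exp (- merge_rate k * x)"
  have eq: "coalescent_cdf i x = (\<Sum>k. ?a k i)" for i
    unfolding coalescent_cdf_def
    by (rule suminf_finite[symmetric]) (auto simp: merge_coeff_eq_0)
  have coeff: "(\<lambda>i. merge_coeff i k) \<longlonglongrightarrow> 1" for k
  proof -
    have *: "(\<lambda>i. (real (Suc i) - real l) / (real (Suc i) + real l)) \<longlonglongrightarrow> 1" for l
    proof -
      have "(\<lambda>i. (1 - real l * inverse (real (Suc i))) / (1 + real l * inverse (real (Suc i))))
          \<longlonglongrightarrow> (1 - real l * 0) / (1 + real l * 0)"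
        by (intro tendsto_intros LIMSEQ_inverse_real_of_nat) auto
      moreover have "(1 - real l * inverse (real (Suc i))) / (1 + real l * inverse (real (Suc i)))
          = (real (Suc i) - real l) / (real (Suc i) + real l)" for i
        by (simp add: divide_simps)
      ultimately show ?thesis by simp
    qed
    show ?thesis
      unfolding merge_coeff_def using tendsto_prod[OF *, of "\<lambda>l. l" "{1..k}"] by simp
  qed
  have "(\<lambda>i. suminf (\<lambda>k. ?a k i)) \<longlonglongrightarrow> (\<Sum>k. (- 1) ^ k * (2 * real k + 1) * 1 * exp (- merge_rate k * x))"
  \<comment> \<open>Dominated convergence for series: the coefficients lie between 0 and 1, so the
    terms of the limit series, taken in absolute value, dominate for all \<open>i\<close> at
    once.\<close>
  proof (rule tannerys_theorem[THEN conjunct2, THEN conjunct2])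
    show "(\<lambda>i. ?a k i) \<longlonglongrightarrow> (- 1) ^ k * (2 * real k + 1) * 1 * exp (- merge_rate k * x)" for k
      by (intro tendsto_intros coeff)
    show "summable (\<lambda>k. \<bar>(- 1) ^ k * (2 * real k + 1) * exp (- merge_rate k * x)\<bar>)"
      using assms merge_coeffs_bound(1) by (rule summable_exp_merge_rate)
    show "\<forall>\<^sub>F (k, i) in sequentially \<times>\<^sub>F sequentially. norm (?a k i)
        \<le> \<bar>(- 1) ^ k * (2 * real k + 1) * exp (- merge_rate k * x)\<bar>"
    proof (rule always_eventually, safe)
      fix k i
      have "(2 * real k + 1) * merge_coeff i k * exp (- merge_rate k * x)
          \<le> (2 * real k + 1) * 1 * exp (- merge_rate k * x)"
        by (intro mult_right_mono mult_left_mono merge_coeff_le_1) auto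
      then show "norm (?a k i) \<le> \<bar>(- 1) ^ k * (2 * real k + 1) * exp (- merge_rate k * x)\<bar>"
        by (simp add: abs_mult merge_coeff_nonneg)
    qed
  qed simp
  then show ?thesis
    unfolding eq full_coalescence_cdf_def by simp
qed

section \<open>Convergence of the occupancy chain\<close>

lemma collapsed_Suc_le: "collapsed (Suc j) \<le> collapsed j"
  by (simp add: collapsed_def)

lemma image_iter_collapsed_nonneg: "i < n \<Longrightarrow> 0 \<le> image_iter n t collapsed i"
  using image_iter_mono[of i n "\<lambda>_. 0" collapsed t] by (simp add: image_iter_const collapsed_def)

lemma image_iter_collapsed_antimono:
  assumes "i \<le> j" "j < n"
  shows "image_iter n t collapsed j \<le> image_iter n t collapsed i"
  using assms
proof (induction j rule: dec_induct)
  case (step j)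
  then show ?case
    using image_iter_antimono[of j n collapsed t] collapsed_Suc_le by (auto intro: order_trans)
qed simp

lemma image_iter_collapsed_mono_time:
  assumes "s \<le> t" "i < n"
  shows "image_iter n s collapsed i \<le> image_iter n t collapsed i"
  using assms(1)
proof (induction t rule: dec_induct)
  case (step t)
  have "collapsed j \<le> image_mean n collapsed j" if "j < n" for j
    using image_iter_collapsed_nonneg[of j n 1] that by (cases j) (auto simp: collapsed_def)
  then have "image_iter n t collapsed i \<le> image_iter n t (image_mean n collapsed) i"
    using assms(2) by (intro image_iter_mono)
  with step show ?case by (simp add: funpow_swap1)
qed simp

text \<open>Markov's inequality without conditioning: with \<open>u\<close> the collapse probability
  from \<open>m\<close> in \<open>r\<close> steps, the linear function
  \<open>u * (1 - j / (m + 1))\<close> lies below that probability from any state \<open>j\<close>,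
  by monotonicity for \<open>j \<le> m\<close> and because it is nonpositive for
  \<open>j > m\<close>. Its mean after \<open>s\<close> steps involves only the mean state.\<close>

lemma image_iter_collapsed_ge:
  assumes "m < n"
  shows "(1 - 3 * n / (real s + 2) / (real m + 1)) * image_iter n r collapsed m
    \<le> image_iter n (s + r) collapsed (n - 1)"
proof -
  define u where "u = image_iter n r collapsed m"
  have u: "0 \<le> u" unfolding u_def using assms by (rule image_iter_collapsed_nonneg)
  have "(1 - 3 * n / (real s + 2) / (real m + 1)) * u \<le> (1 - image_iter n s real (n - 1) / (real m + 1)) * u"
    using image_iter_real_le[of n s] assms u by (intro mult_right_mono diff_left_mono divide_right_mono) auto
  also have "\<dots> = image_iter n s (\<lambda>j. u * 1 + (- u / (real m + 1)) * real j) (n - 1)"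
    unfolding image_iter_linear image_iter_const by (simp add: algebra_simps)
  also have "\<dots> \<le> image_iter n s (image_iter n r collapsed) (n - 1)"
  proof (rule image_iter_mono)
    fix j assume j: "j < n"
    have eq: "u * 1 + (- u / (real m + 1)) * real j = u * (1 - real j / (real m + 1))"
      by (simp add: algebra_simps)
    show "u * 1 + (- u / (real m + 1)) * real j \<le> image_iter n r collapsed j"
    proof (cases "j \<le> m")
      case True
      have "u * (1 - real j / (real m + 1)) \<le> u * 1"
        using u by (intro mult_left_mono) auto
      moreover have "u \<le> image_iter n r collapsed j"
        unfolding u_def using True assms by (rule image_iter_collapsed_antimono)
      ultimately show ?thesis unfolding eq by linarith
    next
      case False
      have "u * (1 - real j / (real m + 1)) \<le> 0"
        using u False by (intro mult_nonneg_nonpos) auto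
      then show ?thesis
        unfolding eq using image_iter_collapsed_nonneg[OF j, of r] by linarith
    qed
  qed (use assms in auto)
  finally show ?thesis by (simp add: u_def funpow_add)
qed

section \<open>Passage to the limit in rescaled time\<close>

lemma floor_mult_over_tendsto:
  assumes "0 \<le> x"
  shows "(\<lambda>n. real (nat \<lfloor>x * real n\<rfloor>) / real n) \<longlonglongrightarrow> x"
proof (rule tendsto_sandwich)
  show "\<forall>\<^sub>F n in sequentially. x - 1 / real n \<le> real (nat \<lfloor>x * real n\<rfloor>) / real n"
  proof (intro eventually_mono[OF eventually_gt_at_top[of 0]])
    fix n :: nat assume "0 < n"
    then have "x - 1 / real n = (x * real n - 1) / real n" by (simp add: diff_divide_distrib)
    also have "\<dots> \<le> real (nat \<lfloor>x * real n\<rfloor>) / real n"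
      using assms real_of_int_floor_add_one_ge[of "x * real n"] by (intro divide_right_mono) auto
    finally show "x - 1 / real n \<le> real (nat \<lfloor>x * real n\<rfloor>) / real n" .
  qed
  show "\<forall>\<^sub>F n in sequentially. real (nat \<lfloor>x * real n\<rfloor>) / real n \<le> x"
    using assms by (intro eventually_mono[OF eventually_gt_at_top[of 0]]) (simp add: field_simps)
  show "(\<lambda>n. x - 1 / real n) \<longlonglongrightarrow> x"
    using tendsto_diff[OF tendsto_const[of x] lim_1_over_n] by simp
qed simp

lemma isCont_coalescent_cdf: "isCont (coalescent_cdf m) x"
  unfolding coalescent_cdf_def by (intro continuous_intros)

lemma image_iter_fixed_tendsto:
  assumes "(\<lambda>n. real (t n) / real n) \<longlonglongrightarrow> x"
  shows "(\<lambda>n. image_iter n (t n) collapsed m) \<longlonglongrightarrow> coalescent_cdf m x"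
proof -
  obtain K where K: "\<And>n t i. i \<le> m \<Longrightarrow> m < n \<Longrightarrow>
    \<bar>image_iter n t collapsed i - coalescent_cdf i (t / n)\<bar> \<le> t * (K / (real n)\<^sup>2)"
    using image_iter_coalescent_cdf[of m] by blast
  have "(\<lambda>n. image_iter n (t n) collapsed m - coalescent_cdf m (t n / n)) \<longlonglongrightarrow> 0"
  proof (rule Lim_null_comparison)
    show "\<forall>\<^sub>F n in sequentially. norm (image_iter n (t n) collapsed m - coalescent_cdf m (t n / n))
        \<le> t n / n * (K * (1 / n))"
    proof (intro eventually_mono[OF eventually_gt_at_top[of m]])
      fix n assume "m < n"
      then show "norm (image_iter n (t n) collapsed m - coalescent_cdf m (t n / n)) \<le> t n / n * (K * (1 / n))"
        using K[of m n "t n"] by (simp add: power2_eq_square)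
    qed
    show "(\<lambda>n. t n / n * (K * (1 / n))) \<longlonglongrightarrow> 0"
      using tendsto_mult[OF assms tendsto_mult[OF tendsto_const[of K] lim_1_over_n]] by simp
  qed
  moreover have "(\<lambda>n. coalescent_cdf m (t n / n)) \<longlonglongrightarrow> coalescent_cdf m x"
    using isCont_coalescent_cdf assms by (rule isCont_tendsto_compose)
  ultimately show ?thesis
    using tendsto_add by fastforce
qed

lemma image_iter_collapsed_tendsto:
  assumes x: "0 < x"
  shows "(\<lambda>n. image_iter n (nat \<lfloor>x * real n\<rfloor>) collapsed (n - 1)) \<longlonglongrightarrow> full_coalescence_cdf x"
proof (rule order_tendstoI)
  fix a assume "full_coalescence_cdf x < a"
  then obtain m where m: "coalescent_cdf m x < a"
    using order_tendstoD(2)[OF coalescent_cdf_tendsto[OF x]] by (auto simp: eventually_sequentially)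
  have "\<forall>\<^sub>F n in sequentially. image_iter n (nat \<lfloor>x * real n\<rfloor>) collapsed m < a"
    using m x
    by (intro order_tendstoD(2)[OF image_iter_fixed_tendsto[OF floor_mult_over_tendsto]]) auto
  then show "\<forall>\<^sub>F n in sequentially. image_iter n (nat \<lfloor>x * real n\<rfloor>) collapsed (n - 1) < a"
    using eventually_gt_at_top[of m]
  proof eventually_elim
    case (elim n)
    then show ?case
      using image_iter_collapsed_antimono[of m "n - 1" n "nat \<lfloor>x * real n\<rfloor>"] by linarith
  qed
next
  fix a assume a: "a < full_coalescence_cdf x"
  have cont: "isCont full_coalescence_cdf x"
    using full_coalescence_cdf_deriv[OF x] by (rule DERIV_isCont)
  \<comment> \<open>The denominators start at 2 so that the time lost, \<open>x / (j + 2)\<close>,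
    lies strictly between 0 and \<open>x\<close>.\<close>
  have "(\<lambda>j. x - x / real (Suc (Suc j))) \<longlonglongrightarrow> x - 0"
    by (intro tendsto_diff tendsto_const LIMSEQ_Suc[of "\<lambda>j. x / real (Suc j)"] LIMSEQ_Suc[of "\<lambda>j. x / real j"])
      (rule lim_const_over_n)
  then have "(\<lambda>j. full_coalescence_cdf (x - x / real (Suc (Suc j)))) \<longlonglongrightarrow> full_coalescence_cdf x"
    using isCont_tendsto_compose[OF cont] by simp
  from eventually_happens'[OF _ order_tendstoD(1)[OF this a]]
  obtain j where j: "a < full_coalescence_cdf (x - x / real (Suc (Suc j)))"
    by auto
  define e where "e = x / real (Suc (Suc j))"
  have e: "0 < e" "e < x" "a < full_coalescence_cdf (x - e)"
    using x j by (auto simp: e_def divide_less_eq)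
  \<comment> \<open>With \<open>e\<close> fixed, \<open>m\<close> is chosen so large that the
    limiting Markov factor \<open>1 - 3 / (e (m + 1))\<close> no longer spoils the strict
    inequality; only then does \<open>n\<close> tend to infinity.\<close>
  have "(\<lambda>m. (1 - 3 / e * inverse (real (Suc m))) * coalescent_cdf m (x - e))
      \<longlonglongrightarrow> (1 - 3 / e * 0) * full_coalescence_cdf (x - e)"
    using e by (intro tendsto_intros LIMSEQ_inverse_real_of_nat coalescent_cdf_tendsto) auto
  then have "\<forall>\<^sub>F m in sequentially. a < (1 - 3 / e * inverse (real (Suc m))) * coalescent_cdf m (x - e)"
    using e(3) by (intro order_tendstoD(1)) auto
  from eventually_happens'[OF _ this]
  obtain m where m: "a < (1 - 3 / e * inverse (real (Suc m))) * coalescent_cdf m (x - e)"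
    by auto
  define s where "s n = nat \<lfloor>e * real n\<rfloor>" for n :: nat
  \<comment> \<open>Taking \<open>r\<close> as a difference instead of a second floor makes
    \<open>s n + r n\<close> exactly the total number of steps.\<close>
  define r where "r n = nat \<lfloor>x * real n\<rfloor> - s n" for n :: nat
  have sr: "s n + r n = nat \<lfloor>x * real n\<rfloor>" for n
  proof -
    have "s n \<le> nat \<lfloor>x * real n\<rfloor>"
      unfolding s_def using e by (intro nat_mono floor_mono mult_right_mono) auto
    then show ?thesis by (simp add: r_def)
  qed
  have s: "(\<lambda>n. s n / n) \<longlonglongrightarrow> e"
    unfolding s_def using e by (intro floor_mult_over_tendsto) auto
  have "(\<lambda>n. nat \<lfloor>x * real n\<rfloor> / n - s n / n) \<longlonglongrightarrow> x - e"
    using x by (intro tendsto_diff s floor_mult_over_tendsto) auto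
  then have "(\<lambda>n. r n / n) \<longlonglongrightarrow> x - e"
    unfolding sr[symmetric] by (simp add: add_divide_distrib)
  then have r: "(\<lambda>n. image_iter n (r n) collapsed m) \<longlonglongrightarrow> coalescent_cdf m (x - e)"
    by (rule image_iter_fixed_tendsto)
  have "(\<lambda>n. (1 - 3 / (s n / n + 2 / n) * inverse (real (Suc m))) * image_iter n (r n) collapsed m)
      \<longlonglongrightarrow> (1 - 3 / (e + 0) * inverse (real (Suc m))) * coalescent_cdf m (x - e)"
    using e by (intro tendsto_intros s r lim_const_over_n) auto
  then have "\<forall>\<^sub>F n in sequentially.
      a < (1 - 3 / (s n / n + 2 / n) * inverse (real (Suc m))) * image_iter n (r n) collapsed m"
    using m by (intro order_tendstoD(1)) auto
  then show "\<forall>\<^sub>F n in sequentially. a < image_iter n (nat \<lfloor>x * real n\<rfloor>) collapsed (n - 1)"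
    using eventually_gt_at_top[of m]
  proof eventually_elim
    case (elim n)
    have "3 / (s n / n + 2 / n) * inverse (real (Suc m)) = 3 * n / (real (s n) + 2) / (real m + 1)"
      using elim(2) by (simp add: field_simps)
    with elim image_iter_collapsed_ge[of m n "s n" "r n"] show ?case
      unfolding sr by simp
  qed
qed

text \<open>Not visible from the alternating series; it is inherited from the monotonicity in time
  of the chain. It is what makes the density nonnegative.\<close>

lemma full_coalescence_cdf_mono:
  assumes "0 < x" "x \<le> y"
  shows "full_coalescence_cdf x \<le> full_coalescence_cdf y"
proof (rule LIMSEQ_le)
  show "(\<lambda>n. image_iter n (nat \<lfloor>x * real n\<rfloor>) collapsed (n - 1)) \<longlonglongrightarrow> full_coalescence_cdf x"
    "(\<lambda>n. image_iter n (nat \<lfloor>y * real n\<rfloor>) collapsed (n - 1)) \<longlonglongrightarrow> full_coalescence_cdf y"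
    using assms by (intro image_iter_collapsed_tendsto; simp)+
  show "\<exists>N. \<forall>n\<ge>N. image_iter n (nat \<lfloor>x * real n\<rfloor>) collapsed (n - 1)
      \<le> image_iter n (nat \<lfloor>y * real n\<rfloor>) collapsed (n - 1)"
    using assms
    by (intro exI[of _ 1] allI impI image_iter_collapsed_mono_time nat_mono floor_mono mult_right_mono) auto
qed

lemma full_coalescence_cdf_bounds:
  assumes "0 < x"
  shows "0 \<le> full_coalescence_cdf x" "full_coalescence_cdf x \<le> 1 - exp (- x)"
proof -
  note lim = image_iter_collapsed_tendsto[OF assms]
  show "0 \<le> full_coalescence_cdf x"
    by (rule LIMSEQ_le_const[OF lim]) (auto intro!: exI[of _ 1] image_iter_collapsed_nonneg)
  have "full_coalescence_cdf x \<le> coalescent_cdf 1 x"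
  proof (rule LIMSEQ_le[OF lim])
    show "(\<lambda>n. image_iter n (nat \<lfloor>x * real n\<rfloor>) collapsed 1) \<longlonglongrightarrow> coalescent_cdf 1 x"
      using assms by (intro image_iter_fixed_tendsto floor_mult_over_tendsto) auto
    show "\<exists>N. \<forall>n\<ge>N. image_iter n (nat \<lfloor>x * real n\<rfloor>) collapsed (n - 1)
        \<le> image_iter n (nat \<lfloor>x * real n\<rfloor>) collapsed 1"
      by (intro exI[of _ 2] allI impI image_iter_collapsed_antimono) auto
  qed
  also have "coalescent_cdf 1 x = 1 - exp (- x)"
    by (simp add: coalescent_cdf_def merge_coeff_def merge_rate_def)
  finally show "full_coalescence_cdf x \<le> 1 - exp (- x)" .
qed

text \<open>The primitive is monotone, so the density is nonnegative, and it tends to 0 at 0 by the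
  bounds above. The fundamental theorem for nonnegative functions then handles the improper endpoint
  0 using only one-sided limits of the primitive.\<close>

lemma limit_cdf_eq:
  assumes "0 < x"
  shows "limit_cdf x = full_coalescence_cdf x"
proof -
  have "(LBINT y=ereal 0..ereal x. limit_density y) = full_coalescence_cdf x - 0"
  proof (rule interval_integral_FTC_nonneg)
    show "ereal 0 < ereal x" using assms by simp
    show "(full_coalescence_cdf has_real_derivative limit_density y) (at y)"
      if "ereal 0 < ereal y" for y
      using that by (intro full_coalescence_cdf_deriv) simp
    show "isCont limit_density y" if "ereal 0 < ereal y" for y
      using that by (intro isCont_limit_density) simp
    have "0 \<le> limit_density y" if "0 < y" for y
    proof (rule mono_on_imp_deriv_nonneg[of "{0<..}" full_coalescence_cdf _ y])
      show "mono_on {0<..} full_coalescence_cdf"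
        by (auto intro!: mono_onI full_coalescence_cdf_mono)
      show "y \<in> interior {0<..}" using that by (simp add: interior_open)
    qed (rule full_coalescence_cdf_deriv[OF that])
    then show "AE y in lborel. ereal 0 < ereal y \<longrightarrow> ereal y < ereal x \<longrightarrow> 0 \<le> limit_density y"
      by simp
    show "((full_coalescence_cdf \<circ> real_of_ereal) \<longlongrightarrow> 0) (at_right (ereal 0))"
      unfolding ereal_tendsto_simps
    proof (rule tendsto_sandwich)
      show "\<forall>\<^sub>F y in at_right 0. (0::real) \<le> full_coalescence_cdf y"
        "\<forall>\<^sub>F y in at_right 0. full_coalescence_cdf y \<le> 1 - exp (- y)"
        using eventually_at_right_less[of "0::real"]
        by (auto elim!: eventually_mono intro: full_coalescence_cdf_bounds)
      have "((\<lambda>y::real. 1 - exp (- y)) \<longlongrightarrow> 1 - exp (- 0)) (at_right 0)"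
        by (intro tendsto_intros)
      then show "((\<lambda>y::real. 1 - exp (- y)) \<longlongrightarrow> 0) (at_right 0)" by simp
    qed simp
    have "isCont full_coalescence_cdf x"
      using full_coalescence_cdf_deriv[OF assms] by (rule DERIV_isCont)
    then show "((full_coalescence_cdf \<circ> real_of_ereal) \<longlongrightarrow> full_coalescence_cdf x) (at_left (ereal x))"
      unfolding ereal_tendsto_simps isCont_def by (rule filterlim_mono) (auto intro: at_le)
  qed
  then show ?thesis by (simp add: limit_cdf_def zero_ereal_def)
qed

section \<open>Compositions of random functions\<close>

text \<open>The combinatorial meaning of \<open>throw_ball\<close>: of the \<open>n\<close> boxes
  for the next ball, \<open>card A\<close> are occupied. Nonemptiness of \<open>A\<close> is
  required by the shift of states by one.\<close>

lemma sum_card_insert: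
  fixes h :: "nat \<Rightarrow> real"
  assumes "A \<subseteq> {1..n}" "A \<noteq> {}"
  shows "(\<Sum>y\<in>{1..n}. h (card (insert y A) - 1)) = real n * throw_ball n h (card A - 1)"
proof -
  have fin: "finite A" using assms finite_subset by blast
  then obtain c where c: "card A = Suc c" using assms by (cases "card A") auto
  have n: "Suc c \<le> n" using card_mono[OF _ assms(1)] c by simp
  have old: "(\<Sum>y\<in>A. h (card (insert y A) - 1)) = real (Suc c) * h c"
    using c by (simp add: insert_absorb)
  have "(\<Sum>y\<in>{1..n} - A. h (card (insert y A) - 1)) = (\<Sum>y\<in>{1..n} - A. h (Suc c))"
    using fin c by (intro sum.cong refl) simp
  then have new: "(\<Sum>y\<in>{1..n} - A. h (card (insert y A) - 1)) = (real n - real (Suc c)) * h (Suc c)"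
    using assms fin c n by (simp add: card_Diff_subset of_nat_diff)
  have "(\<Sum>y\<in>{1..n}. h (card (insert y A) - 1))
      = (real n - real (Suc c)) * h (Suc c) + real (Suc c) * h c"
    unfolding old[symmetric] new[symmetric] using assms by (intro sum.subset_diff) simp_all
  also have "\<dots> = real n * throw_ball n h (card A - 1)"
    using n by (simp add: throw_ball_def c field_simps)
  finally show ?thesis .
qed

lemma sum_maps_on_split:
  assumes "a \<in> {1..n}"
  shows "(\<Sum>\<psi>\<in>maps_on n. F \<psi>) = (\<Sum>g\<in>({1..n} - {a}) \<rightarrow>\<^sub>E {1..n}. \<Sum>y\<in>{1..n}. F (g(a := y)))"
proof -
  have "maps_on n = (\<lambda>(y, g). g(a := y)) ` ({1..n} \<times> (({1..n} - {a}) \<rightarrow>\<^sub>E {1..n}))"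
    using assms PiE_insert_eq[of a "{1..n} - {a}" "\<lambda>_. {1..n}"]
    by (simp add: maps_on_def insert_absorb)
  moreover have "inj_on (\<lambda>(y, g). g(a := y)) ({1..n} \<times> (({1..n} - {a}) \<rightarrow>\<^sub>E {1..n}))"
    by (rule inj_combinator) simp
  ultimately have "(\<Sum>\<psi>\<in>maps_on n. F \<psi>) = (\<Sum>(y, g)\<in>{1..n} \<times> (({1..n} - {a}) \<rightarrow>\<^sub>E {1..n}). F (g(a := y)))"
    by (simp add: sum.reindex case_prod_unfold)
  also have "\<dots> = (\<Sum>y\<in>{1..n}. \<Sum>g\<in>({1..n} - {a}) \<rightarrow>\<^sub>E {1..n}. F (g(a := y)))"
    by (rule sum.cartesian_product[symmetric])
  also have "\<dots> = (\<Sum>g\<in>({1..n} - {a}) \<rightarrow>\<^sub>E {1..n}. \<Sum>y\<in>{1..n}. F (g(a := y)))"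
    by (rule sum.swap)
  finally show ?thesis .
qed

lemma finite_maps_on: "finite (maps_on n)"
  unfolding maps_on_def by (intro finite_PiE) auto

lemma card_maps_on_pos: "0 < card (maps_on n)"
  by (cases "n = 0") (simp_all add: maps_on_def card_funcsetE)

text \<open>A uniform random map throws the points of \<open>S\<close> independently into
  \<open>n\<close> boxes. The induction splits off the value at one point and leaves the map
  elsewhere fixed.\<close>

lemma sum_maps_on_card_image:
  fixes h :: "nat \<Rightarrow> real"
  assumes "S \<subseteq> {1..n}" "S \<noteq> {}"
  shows "(\<Sum>\<psi>\<in>maps_on n. h (card (\<psi> ` S) - 1)) = card (maps_on n) * image_mean n h (card S - 1)"
proof -
  have "finite S" using assms(1) finite_subset by blast
  from this assms(2,1) show ?thesis
  proof (induction S arbitrary: h rule: finite_ne_induct)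
    case (singleton a)
    then show ?case by simp
  next
    case (insert a S)
    let ?G = "({1..n} - {a}) \<rightarrow>\<^sub>E {1..n}"
    have a: "a \<in> {1..n}" and S: "S \<subseteq> {1..n} - {a}" using insert by auto
    have upd: "g(a := y) ` S = g ` S" for g :: "nat \<Rightarrow> nat" and y
      using insert.hyps by auto
    have "(\<Sum>\<psi>\<in>maps_on n. h (card (\<psi> ` insert a S) - 1))
        = (\<Sum>g\<in>?G. \<Sum>y\<in>{1..n}. h (card (insert y (g ` S)) - 1))"
      unfolding sum_maps_on_split[OF a] by (simp only: image_insert upd fun_upd_same)
    \<comment> \<open>The summand on the right does not depend on \<open>y\<close>, since
      \<open>a\<close> is not in \<open>S\<close>; keeping the sum over \<open>y\<close> absorbs the
      factor \<open>n\<close> and restores a sum over all maps.\<close>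
    also have "\<dots> = (\<Sum>g\<in>?G. \<Sum>y\<in>{1..n}. throw_ball n h (card (g(a := y) ` S) - 1))"
    proof (rule sum.cong[OF refl])
      fix g assume g: "g \<in> ?G"
      have "g ` S \<subseteq> {1..n}" using g S by (auto simp: PiE_iff)
      then show "(\<Sum>y\<in>{1..n}. h (card (insert y (g ` S)) - 1))
          = (\<Sum>y\<in>{1..n}. throw_ball n h (card (g(a := y) ` S) - 1))"
        unfolding upd using insert.hyps by (subst sum_card_insert) auto
    qed
    also have "\<dots> = (\<Sum>\<psi>\<in>maps_on n. throw_ball n h (card (\<psi> ` S) - 1))"
      unfolding sum_maps_on_split[OF a] ..
    also have "\<dots> = card (maps_on n) * image_mean n (throw_ball n h) (card S - 1)"
      using insert by (intro insert.IH) auto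
    also have "image_mean n (throw_ball n h) (card S - 1) = image_mean n h (card (insert a S) - 1)"
    proof -
      obtain c where "card S = Suc c" using insert.hyps by (cases "card S") auto
      then show ?thesis using insert.hyps by simp
    qed
    finally show ?case .
  qed
qed

text \<open>The image of \<open>g\<^sub>t\<close>, extended by the identity at \<open>t = 0\<close>,
  so that inductions start from size \<open>n\<close>; the dummy \<open>\<phi> 0\<close> is never
  read.\<close>

primrec run_image :: "nat \<Rightarrow> (nat \<Rightarrow> nat \<Rightarrow> nat) \<Rightarrow> nat \<Rightarrow> nat set" where
  "run_image n \<phi> 0 = {1..n}"
| "run_image n \<phi> (Suc t) = \<phi> (Suc t) ` run_image n \<phi> t"

lemma run_image_cong:
  assumes "\<And>i. 1 \<le> i \<Longrightarrow> i \<le> t \<Longrightarrow> \<phi> i = \<phi>' i"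
  shows "run_image n \<phi> t = run_image n \<phi>' t"
  using assms by (induction t) simp_all

lemma run_image_subset:
  assumes "1 \<le> n" "\<And>i. 1 \<le> i \<Longrightarrow> \<phi> i \<in> maps_on n"
  shows "run_image n \<phi> t \<subseteq> {1..n} \<and> run_image n \<phi> t \<noteq> {}"
proof (induction t)
  case 0
  show ?case using assms(1) by simp
next
  case (Suc t)
  have "\<phi> (Suc t) \<in> {1..n} \<rightarrow>\<^sub>E {1..n}" using assms(2)[of "Suc t"] by (simp add: maps_on_def)
  with Suc show ?case by (auto simp: PiE_iff)
qed

lemma image_iter_comp:
  assumes "1 \<le> t"
  shows "iter_comp n \<phi> t ` {1..n} = run_image n \<phi> t"
  using assms
proof (induction t rule: dec_induct)
  case base
  show ?case by (subst iter_comp.simps) simp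
next
  case (step t)
  have "iter_comp n \<phi> (Suc t) ` {1..n} = \<phi> (Suc t) ` iter_comp n \<phi> t ` {1..n}"
    using step.hyps by (subst iter_comp.simps) (auto simp: compose_def image_image)
  with step show ?case by simp
qed

lemma const_on_iff_card_image:
  assumes "finite A"
  shows "(\<forall>i\<in>A. \<forall>j\<in>A. g i = g j) \<longleftrightarrow> card (g ` A) \<le> 1"
  using card_le_Suc0_iff_eq[of "g ` A"] assms by simp

text \<open>Image sizes never increase, so a composition once constant stays constant, and the
  infimum over times can be tested at time \<open>T\<close> alone.\<close>

lemma hit_const_time_le_iff:
  assumes "1 \<le> T"
  shows "hit_const_time n \<phi> \<le> enat T \<longleftrightarrow> card (run_image n \<phi> T) \<le> 1"
proof -
  have const: "(\<forall>i\<in>{1..n}. \<forall>j\<in>{1..n}. iter_comp n \<phi> t i = iter_comp n \<phi> t j)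
      \<longleftrightarrow> card (run_image n \<phi> t) \<le> 1" if "1 \<le> t" for t
    unfolding image_iter_comp[OF that, symmetric] by (rule const_on_iff_card_image) simp
  have mono: "card (run_image n \<phi> t) \<le> card (run_image n \<phi> s)" if "s \<le> t" for s t
    using that
  proof (induction t rule: dec_induct)
    case (step t)
    have "finite (run_image n \<phi> t)" by (induction t) auto
    then have "card (run_image n \<phi> (Suc t)) \<le> card (run_image n \<phi> t)"
      by (simp add: card_image_le)
    with step show ?case by simp
  qed simp
  have "hit_const_time n \<phi> \<le> enat T \<longleftrightarrow> hit_const_time n \<phi> < enat (Suc T)"
    by (cases "hit_const_time n \<phi>") auto
  also have "\<dots> \<longleftrightarrow> (\<exists>t. 1 \<le> t \<and> card (run_image n \<phi> t) \<le> 1 \<and> t < Suc T)"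
  proof -
    have "{enat t |t. 1 \<le> t \<and> (\<forall>i\<in>{1..n}. \<forall>j\<in>{1..n}. iter_comp n \<phi> t i = iter_comp n \<phi> t j)}
        = enat ` {t. 1 \<le> t \<and> card (run_image n \<phi> t) \<le> 1}"
      using const by blast
    then show ?thesis
      unfolding hit_const_time_def Inf_less_iff by auto
  qed
  also have "\<dots> \<longleftrightarrow> card (run_image n \<phi> T) \<le> 1"
    using assms mono by (metis le_trans less_Suc_eq_le order_refl)
  finally show ?thesis .
qed

section \<open>Probabilities as iterated means\<close>

context prob_space
begin

lemma expectation_uniform_map:
  fixes F :: "(nat \<Rightarrow> nat) \<Rightarrow> real"
  assumes "g \<in> measurable M (count_space (maps_on n))"
    and "distr M (count_space (maps_on n)) g = uniform_count_measure (maps_on n)"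
  shows "expectation (\<lambda>\<omega>. F (g \<omega>)) = (\<Sum>\<psi>\<in>maps_on n. F \<psi>) / card (maps_on n)"
proof -
  have "expectation (\<lambda>\<omega>. F (g \<omega>)) = integral\<^sup>L (uniform_count_measure (maps_on n)) F"
    unfolding assms(2)[symmetric] using assms(1) by (intro integral_distr[symmetric]) auto
  also have "\<dots> = (\<Sum>\<psi>\<in>maps_on n. F \<psi>) / card (maps_on n)"
    unfolding uniform_count_measure_def
    by (subst lebesgue_integral_point_measure_finite) (auto simp: finite_maps_on sum_divide_distrib)
  finally show ?thesis .
qed

text \<open>The Markov property: split according to the finitely many values \<open>S\<close> of the
  image after \<open>t\<close> steps. The indicator of \<open>S\<close> depends on the first
  \<open>t\<close> maps and is independent of the next one, whose mean effect is
  \<open>image_mean\<close>. The hypothesis for \<open>t\<close> is then applied to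
  \<open>image_mean n h\<close>, hence the general \<open>h\<close>.\<close>

lemma expectation_run_image:
  fixes f :: "nat \<Rightarrow> 'a \<Rightarrow> nat \<Rightarrow> nat" and h :: "nat \<Rightarrow> real"
  assumes n: "1 \<le> n"
    and indep: "indep_vars (\<lambda>t. count_space (maps_on n)) f {1..}"
    and unif: "\<And>t. 1 \<le> t \<Longrightarrow>
      distr M (count_space (maps_on n)) (f t) = uniform_count_measure (maps_on n)"
  shows "expectation (\<lambda>\<omega>. h (card (run_image n (\<lambda>t. f t \<omega>) t) - 1)) = image_iter n t h (n - 1)"
proof (induction t arbitrary: h)
  case 0
  show ?case by (simp add: prob_space)
next
  case (Suc t)
  define Y where "Y \<omega> = run_image n (\<lambda>t. f t \<omega>) t" for \<omega>
  define D where "D = {S. S \<subseteq> {1..n} \<and> S \<noteq> {}}"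
  define Z :: "nat set \<Rightarrow> 'a \<Rightarrow> real" where "Z S \<omega> = indicator {S} (Y \<omega>)" for S \<omega>
  define W where "W S \<omega> = h (card (f (Suc t) \<omega> ` S) - 1)" for S \<omega>
  have D: "finite D" unfolding D_def by (rule finite_subset[of _ "Pow {1..n}"]) auto
  have rv: "f i \<in> measurable M (count_space (maps_on n))" if "1 \<le> i" for i
    using indep that by (auto simp: indep_vars_def)
  have fD: "f i \<omega> \<in> maps_on n" if "1 \<le> i" "\<omega> \<in> space M" for i \<omega>
    using measurable_space[OF rv] that by simp
  have Y: "Y \<omega> \<in> D" if "\<omega> \<in> space M" for \<omega>
    unfolding Y_def D_def using run_image_subset[OF n, of "\<lambda>t. f t \<omega>" t] fD that by auto
  have pick: "G (Y \<omega>) = (\<Sum>S\<in>D. Z S \<omega> * G S)" if "\<omega> \<in> space M" for \<omega> and G :: "nat set \<Rightarrow> real"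
  proof -
    have "(\<Sum>S\<in>D. Z S \<omega> * G S) = (\<Sum>S\<in>D. if S = Y \<omega> then G S else 0)"
      by (intro sum.cong) (auto simp: Z_def)
    then show ?thesis using D Y[OF that] by simp
  qed
  have ind: "indep_var borel (Z S) borel (W S)" for S
  proof -
    have "indep_var (PiM {1..t} (\<lambda>_. count_space (maps_on n))) (\<lambda>\<omega>. \<lambda>i\<in>{1..t}. f i \<omega>)
        (PiM {Suc t} (\<lambda>_. count_space (maps_on n))) (\<lambda>\<omega>. \<lambda>i\<in>{Suc t}. f i \<omega>)"
      by (rule indep_var_restrict[OF indep]) auto
    \<comment> \<open>Finite products of finite discrete spaces are discrete, so every function of
      the first \<open>t\<close> maps, or of the next one, is measurable.\<close>
    then have "indep_var (count_space ({1..t} \<rightarrow>\<^sub>E maps_on n)) (\<lambda>\<omega>. \<lambda>i\<in>{1..t}. f i \<omega>)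
        (count_space ({Suc t} \<rightarrow>\<^sub>E maps_on n)) (\<lambda>\<omega>. \<lambda>i\<in>{Suc t}. f i \<omega>)"
      by (simp add: count_space_PiM_finite finite_maps_on countable_finite)
    then have "indep_var borel ((\<lambda>\<phi>. indicator {S} (run_image n \<phi> t)) \<circ> (\<lambda>\<omega>. \<lambda>i\<in>{1..t}. f i \<omega>))
        borel ((\<lambda>\<phi>. h (card (\<phi> (Suc t) ` S) - 1)) \<circ> (\<lambda>\<omega>. \<lambda>i\<in>{Suc t}. f i \<omega>))"
      by (rule indep_var_compose) auto
    moreover have "run_image n (\<lambda>i\<in>{1..t}. f i \<omega>) t = Y \<omega>" for \<omega>
      unfolding Y_def by (rule run_image_cong) simp
    ultimately show ?thesis
      by (simp add: comp_def Z_def[abs_def] W_def[abs_def])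
  qed
  have intZ: "integrable M (Z S)" for S
    using indep_var_rv1[OF ind] by (intro integrable_const_bound[of _ 1]) (auto simp: Z_def indicator_def)
  have intW: "integrable M (W S)" if "S \<in> D" for S
  proof (rule integrable_const_bound)
    show "AE \<omega> in M. norm (W S \<omega>) \<le> (\<Sum>j\<le>card S. \<bar>h j\<bar>)"
    proof (rule AE_I2)
      fix \<omega>
      have "finite S" using that by (auto simp: D_def intro: finite_subset)
      then have "card (f (Suc t) \<omega> ` S) - 1 \<le> card S"
        using card_image_le[of S "f (Suc t) \<omega>"] by simp
      then show "norm (W S \<omega>) \<le> (\<Sum>j\<le>card S. \<bar>h j\<bar>)"
        unfolding W_def real_norm_def by (intro member_le_sum) auto
    qed
  qed (rule indep_var_rv2[OF ind])
  have EW: "expectation (W S) = image_mean n h (card S - 1)" if "S \<in> D" for S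
  proof -
    have "expectation (W S) = (\<Sum>\<psi>\<in>maps_on n. h (card (\<psi> ` S) - 1)) / card (maps_on n)"
      unfolding W_def by (rule expectation_uniform_map) (auto intro: rv unif)
    then show ?thesis
      using that sum_maps_on_card_image[of S n h] card_maps_on_pos[of n] by (simp add: D_def)
  qed
  have "expectation (\<lambda>\<omega>. h (card (run_image n (\<lambda>t. f t \<omega>) (Suc t)) - 1))
      = expectation (\<lambda>\<omega>. \<Sum>S\<in>D. Z S \<omega> * W S \<omega>)"
  proof (intro Bochner_Integration.integral_cong refl)
    fix \<omega> assume "\<omega> \<in> space M"
    from pick[OF this, of "\<lambda>S. W S \<omega>"]
    show "h (card (run_image n (\<lambda>t. f t \<omega>) (Suc t)) - 1) = (\<Sum>S\<in>D. Z S \<omega> * W S \<omega>)"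
      by (simp add: W_def Y_def)
  qed
  also have "\<dots> = (\<Sum>S\<in>D. expectation (\<lambda>\<omega>. Z S \<omega> * W S \<omega>))"
    using indep_var_integrable[OF ind intZ intW] by (intro Bochner_Integration.integral_sum) auto
  also have "\<dots> = (\<Sum>S\<in>D. expectation (Z S) * image_mean n h (card S - 1))"
    by (intro sum.cong refl) (simp add: indep_var_lebesgue_integral[OF ind intZ intW] EW)
  also have "\<dots> = expectation (\<lambda>\<omega>. \<Sum>S\<in>D. Z S \<omega> * image_mean n h (card S - 1))"
    using intZ by (subst Bochner_Integration.integral_sum) auto
  \<comment> \<open>The decomposition over \<open>S\<close> is undone, now with the averaged
    function in place of \<open>W\<close>.\<close>
  also have "\<dots> = expectation (\<lambda>\<omega>. image_mean n h (card (Y \<omega>) - 1))"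
    by (intro Bochner_Integration.integral_cong refl pick[symmetric])
  also have "\<dots> = image_iter n t (image_mean n h) (n - 1)"
    unfolding Y_def by (rule Suc.IH)
  finally show ?case by (simp add: funpow_swap1)
qed

lemma prob_hit_const_time_le:
  fixes f :: "nat \<Rightarrow> 'a \<Rightarrow> nat \<Rightarrow> nat"
  assumes n: "1 \<le> n" and T: "1 \<le> T"
    and indep: "indep_vars (\<lambda>t. count_space (maps_on n)) f {1..}"
    and unif: "\<And>t. 1 \<le> t \<Longrightarrow>
      distr M (count_space (maps_on n)) (f t) = uniform_count_measure (maps_on n)"
  shows "prob {\<omega> \<in> space M. hit_const_time n (\<lambda>t. f t \<omega>) \<le> enat T} = image_iter n T collapsed (n - 1)"
proof -
  let ?A = "{\<omega> \<in> space M. hit_const_time n (\<lambda>t. f t \<omega>) \<le> enat T}"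
  have "prob ?A = prob (?A \<inter> space M)" by (rule arg_cong[where f = prob]) auto
  also have "\<dots> = expectation (indicator ?A)" by simp
  also have "\<dots> = expectation (\<lambda>\<omega>. collapsed (card (run_image n (\<lambda>t. f t \<omega>) T) - 1))"
    by (intro Bochner_Integration.integral_cong refl)
      (auto simp: hit_const_time_le_iff[OF T] collapsed_def indicator_def)
  also have "\<dots> = image_iter n T collapsed (n - 1)"
    using n indep unif by (rule expectation_run_image)
  finally show ?thesis .
qed

end

lemma ereal_of_enat_div_le_iff:
  assumes "0 < n" "0 \<le> x"
  shows "ereal_of_enat k / ereal (real n) \<le> ereal x \<longleftrightarrow> k \<le> enat (nat \<lfloor>x * real n\<rfloor>)"
proof (cases k)
  case (enat m)
  have "real m / real n \<le> x \<longleftrightarrow> real m \<le> x * real n"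
    using assms by (simp add: field_simps)
  also have "\<dots> \<longleftrightarrow> m \<le> nat \<lfloor>x * real n\<rfloor>"
    using assms by (simp add: le_nat_floor le_nat_iff le_floor_iff)
  finally show ?thesis using enat assms by simp
qed (use assms in simp)

theorem theorem3:
  fixes M :: "nat \<Rightarrow> 'a measure"
    and f :: "nat \<Rightarrow> nat \<Rightarrow> 'a \<Rightarrow> nat \<Rightarrow> nat"
    and x :: real
  assumes prob: "\<And>n. 2 \<le> n \<Longrightarrow> prob_space (M n)"
    and indep: "\<And>n. 2 \<le> n \<Longrightarrow>
      prob_space.indep_vars (M n) (\<lambda>t. count_space (maps_on n)) (f n) {1..}"
    and unif: "\<And>n t. 2 \<le> n \<Longrightarrow> 1 \<le> t \<Longrightarrow>
      distr (M n) (count_space (maps_on n)) (f n t) = uniform_count_measure (maps_on n)"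
    and x: "0 < x"
  shows "(\<lambda>n. measure (M n) {\<omega> \<in> space (M n).
            ereal_of_enat (hit_const_time n (\<lambda>t. f n t \<omega>)) / ereal (real n) \<le> ereal x})
         \<longlonglongrightarrow> limit_cdf x"
proof -
  \<comment> \<open>For \<open>n \<ge> N\<close> the number of steps
    \<open>nat \<lfloor>x * real n\<rfloor>\<close> is at least 1, as the hitting time starts at
    1.\<close>
  obtain N :: nat where N: "1 / x < real N" using reals_Archimedean2 by blast
  have "\<forall>\<^sub>F n in sequentially. image_iter n (nat \<lfloor>x * real n\<rfloor>) collapsed (n - 1)
      = measure (M n) {\<omega> \<in> space (M n).
          ereal_of_enat (hit_const_time n (\<lambda>t. f n t \<omega>)) / ereal (real n) \<le> ereal x}"
    using eventually_ge_at_top[of "max 2 N"]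
  proof eventually_elim
    case (elim n)
    interpret prob_space "M n" using elim by (intro prob) simp
    have "1 / x \<le> real n" using N elim by simp
    then have "1 \<le> x * real n" using x by (simp add: field_simps)
    then have T: "1 \<le> nat \<lfloor>x * real n\<rfloor>" by (simp add: le_nat_iff)
    have "{\<omega> \<in> space (M n). ereal_of_enat (hit_const_time n (\<lambda>t. f n t \<omega>)) / ereal (real n) \<le> ereal x}
        = {\<omega> \<in> space (M n). hit_const_time n (\<lambda>t. f n t \<omega>) \<le> enat (nat \<lfloor>x * real n\<rfloor>)}"
      using elim x by (intro Collect_cong conj_cong refl ereal_of_enat_div_le_iff) auto
    then show ?case
      using prob_hit_const_time_le[OF _ T indep[of n] unif[of n]] elim by simp
  qed
  then show ?thesis
    unfolding limit_cdf_eq[OF x]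
    by (rule Lim_transform_eventually[OF image_iter_collapsed_tendsto[OF x]])
qed

end
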